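(* Let $(\mathcal{V},d)$ be a metric space, let $V=\{v_1,\dots,v_N\}\subseteq\mathcal{V}$ be a finite set, and let $2\le k\le N$ be an integer. Let $d^*=\max_{S'\subseteq V,\,|S'|=k} div(S')$ be the optimal $k$-max-min diversity of $V$. Let a cover tree with base $b>1$ be given for $V$, with layers $C_{i_{\max}},\dots,C_{i_{\min}}$. Let $C_i$ be the termination layer, i.e. the layer with $|C_i|\ge k$ and $|C_j|<k$ for all $j>i$, and define $\beta\in\mathbb{R}^+$ by $b^i=d^*/\beta$. Then: (1) every subset $C\subseteq C_i$ with $|C|\ge 2$ satisfies $div(C)\ge d^*/\beta$; (2) there exists $C\subseteq C_i$ with $|C|=k$ and $$div(C)\ \ge\ \max\left\{\frac{d^*}{\beta},\ d^*\left(1-\frac{1}{\beta}\cdot\frac{2b}{b-1}\right)\right\};$$ (3) $\beta<\frac{2b^2}{b-1}$; (4) consequently, for such a $C$, $\frac{d^*}{div(C)}\le 1+\frac{2b}{b-1}$.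
   Context: For a finite set $S'\subseteq\mathcal{V}$ with at least two points, its diversity is $div(S')=\min_{s,s'\in S',\,s\ne s'} d(s,s')$. A cover tree for $V$ with base $b>1$ is a leveled tree whose layers are indexed by integers $i$ with $i_{\min}\le i\le i_{\max}$; each node corresponds to a point of $V$ (a point may correspond to nodes in several layers, but to at most one node per layer); $C_i$ denotes the set of (points of) nodes at level $i$; the lowest layer $C_{i_{\min}}$ equals $V$ and the top layer $C_{i_{\max}}$ consists of a single root. The following invariants hold for all levels: (Nesting) $C_i\subseteq C_{i-1}$; (Covering) for every $p\in C_{i-1}$ there is $q\in C_i$ with $d(p,q)\le b^i$, and the node of $q$ in $C_i$ is the parent of the node of $p$ in $C_{i-1}$; (Separation) for all distinct $p,q\in C_i$, $d(p,q)>b^i$. *)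

theory Defs
  imports Complex_Main
begin

text \<open>
  Only meaningful for finite sets with at least two points, as \<^const>\<open>Min\<close> is unspecified on
  the empty set and on infinite sets.
\<close>
definition diversity :: "'a::metric_space set \<Rightarrow> real" where
  "diversity S = Min {dist s s' | s s'. s \<in> S \<and> s' \<in> S \<and> s \<noteq> s'}"

text \<open>The optimal \<open>k\<close>-max-min diversity; meaningful for finite \<open>V\<close> and \<open>2 \<le> k \<le> card V\<close>.\<close>
definition opt_diversity :: "'a::metric_space set \<Rightarrow> nat \<Rightarrow> real" where
  "opt_diversity V k = Max {diversity S | S. S \<subseteq> V \<and> card S = k}"

text \<open>
  A point occurs at most once per layer, so the nodes of the tree are the pairs \<open>(i, p)\<close> with
  \<open>imin \<le> i \<le> imax\<close> and \<open>p \<in> C i\<close>. The parent of a node \<open>(i, p)\<close> with \<open>i < imax\<close> is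
  \<open>(i + 1, par i p)\<close>. Values of \<open>C\<close> and \<open>par\<close> at other arguments are irrelevant.
\<close>
locale cover_tree =
  fixes V :: "'a::metric_space set"
    and b :: real
    and imin imax :: int
    and C :: "int \<Rightarrow> 'a set"
    and par :: "int \<Rightarrow> 'a \<Rightarrow> 'a"
  assumes base_gt_1: "b > 1"
    and levels: "imin \<le> imax"
    and bottom: "C imin = V"
    and root: "\<exists>r. C imax = {r}"
    and nesting: "\<And>i. imin < i \<Longrightarrow> i \<le> imax \<Longrightarrow> C i \<subseteq> C (i - 1)"
    and covering: "\<And>i p. imin < i \<Longrightarrow> i \<le> imax \<Longrightarrow> p \<in> C (i - 1) \<Longrightarrow>
           par (i - 1) p \<in> C i \<and> dist p (par (i - 1) p) \<le> b powi i"
    and separation: "\<And>i p q. imin \<le> i \<Longrightarrow> i \<le> imax \<Longrightarrow> p \<in> C i \<Longrightarrow> q \<in> C i \<Longrightarrow> p \<noteq> q \<Longrightarrow>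
           dist p q > b powi i"

end

theory Submission
  imports Defs
begin

text \<open>
  Following parents, every point of \<open>V\<close> has an ancestor in layer \<open>j\<close> at distance less than
  \<open>b\<^sup>j\<^sup>+\<^sup>1 / (b - 1)\<close>, by the geometric series. Two points of an optimal set \<open>S\<close> with a common
  ancestor in layer \<open>j\<close> therefore force \<open>d\<^sup>* < 2 b\<^sup>j\<^sup>+\<^sup>1 / (b - 1)\<close>. In layer \<open>i + 1\<close> such a pair
  exists by the pigeonhole principle, which bounds \<open>\<beta>\<close>. In layer \<open>i\<close>, either there is no such
  pair and the ancestors of \<open>S\<close> form the required set, or the second lower bound is negative
  and separation alone makes any \<open>k\<close> points of the layer suitable.
\<close>

lemma finite_pair_dists:
  assumes "finite S"
  shows "finite {dist s s' | s s'. s \<in> S \<and> s' \<in> S \<and> s \<noteq> s'}"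
  by (rule finite_subset[of _ "(\<lambda>(s, s'). dist s s') ` (S \<times> S)"]) (use assms in auto)

lemma diversity_le_dist:
  assumes "finite S" "s \<in> S" "s' \<in> S" "s \<noteq> s'"
  shows "diversity S \<le> dist s s'"
  unfolding diversity_def using assms by (intro Min_le finite_pair_dists) auto

text \<open>The cardinality premise supplies both things that \<open>Min\<close> needs: an infinite
  set has cardinality 0, so \<open>S\<close> is finite, and two distinct points make the set of
  distances nonempty.\<close>

lemma diversity_geI:
  assumes "card S \<ge> 2" and "\<And>s s'. s \<in> S \<Longrightarrow> s' \<in> S \<Longrightarrow> s \<noteq> s' \<Longrightarrow> c \<le> dist s s'"
  shows "c \<le> diversity S"
proof -
  have "finite S" using assms(1) card.infinite by fastforce
  moreover obtain x y where "x \<in> S" "y \<in> S" "x \<noteq> y"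
    using assms(1) card_le_Suc0_iff_eq[OF \<open>finite S\<close>] by fastforce
  ultimately show ?thesis
    unfolding diversity_def using assms(2)
    by (subst Min_ge_iff) (auto intro: finite_pair_dists)
qed

lemma opt_diversity_attained:
  assumes "finite V" "k \<le> card V"
  obtains S where "S \<subseteq> V" "card S = k" "diversity S = opt_diversity V k"
proof -
  let ?D = "{diversity S | S. S \<subseteq> V \<and> card S = k}"
  have "finite ?D"
    by (rule finite_subset[of _ "diversity ` Pow V"]) (use assms(1) in auto)
  moreover obtain S0 where "S0 \<subseteq> V" "card S0 = k"
    using obtain_subset_with_card_n[OF assms(2)] by metis
  hence "?D \<noteq> {}" by blast
  ultimately have "Max ?D \<in> ?D" by (rule Max_in)
  thus ?thesis using that unfolding opt_diversity_def by force
qed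

context cover_tree
begin

lemma layer_subset:
  assumes "imin \<le> j" "j \<le> imax"
  shows "C j \<subseteq> V"
  using assms
proof (induction j rule: int_ge_induct)
  case base
  then show ?case by (simp add: bottom)
next
  case (step j)
  then show ?case using nesting[of "j + 1"] by auto
qed

text \<open>The radius is the full series of all b^l with l \<le> j, including levels below
  \<open>imin\<close>. It is therefore independent of the depth of the tree and strict: in the
  bottom layer \<open>p\<close> is its own ancestor at distance 0, and one step up adds exactly the
  next term of the series.\<close>

lemma ex_ancestor:
  assumes "imin \<le> j" "j \<le> imax" "p \<in> V"
  shows "\<exists>q \<in> C j. dist p q < b powi (j + 1) / (b - 1)"
  using assms(1,2)
proof (induction j rule: int_ge_induct)
  case base
  show ?case using assms(3) base_gt_1 bottom by (intro bexI[of _ p]) auto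
next
  case (step j)
  then obtain q where q: "q \<in> C j" "dist p q < b powi (j + 1) / (b - 1)" by auto
  let ?r = "par j q"
  have r: "?r \<in> C (j + 1)" "dist q ?r \<le> b powi (j + 1)"
    using covering[of "j + 1" q] step q(1) by auto
  have "dist p ?r \<le> dist p q + dist q ?r" by (rule dist_triangle)
  also have "\<dots> < b powi (j + 1) / (b - 1) + b powi (j + 1)"
    using q(2) r(2) by linarith
  also have "\<dots> = b powi (j + 1) * b / (b - 1)"
    using base_gt_1 by (simp add: field_simps)
  also have "\<dots> = b powi (j + 1 + 1) / (b - 1)"
    using base_gt_1 power_int_add_1[of b "j + 1"] by simp
  finally show ?case using r(1) by blast
qed

text \<open>One inequality serves two purposes: if \<open>f s = f s'\<close> it bounds
  \<open>dist s s'\<close> from above, and otherwise it bounds the distance of the ancestors from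
  below.\<close>

lemma ancestors:
  assumes "imin \<le> j" "j \<le> imax" "S \<subseteq> V"
  obtains f where "f ` S \<subseteq> C j"
    and "\<And>s s'. s \<in> S \<Longrightarrow> s' \<in> S \<Longrightarrow>
      dist s s' < dist (f s) (f s') + 2 * (b powi (j + 1) / (b - 1))"
proof -
  obtain f where f: "\<And>p. p \<in> V \<Longrightarrow> f p \<in> C j \<and> dist p (f p) < b powi (j + 1) / (b - 1)"
    using ex_ancestor[OF assms(1,2)] by metis
  show ?thesis
  proof (rule that[of f])
    show "f ` S \<subseteq> C j" using f assms(3) by auto
  next
    fix s s' assume "s \<in> S" "s' \<in> S"
    hence "dist s (f s) < b powi (j + 1) / (b - 1)" "dist s' (f s') < b powi (j + 1) / (b - 1)"
      using f assms(3) by auto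
    thus "dist s s' < dist (f s) (f s') + 2 * (b powi (j + 1) / (b - 1))"
      using dist_triangle[of s s' "f s"] dist_triangle[of "f s" s' "f s'"] dist_commute[of s' "f s'"]
      by linarith
  qed
qed

lemma diversity_layer_ge:
  assumes "imin \<le> j" "j \<le> imax" "T \<subseteq> C j" "card T \<ge> 2"
  shows "b powi j \<le> diversity T"
  using assms separation[of j] by (intro diversity_geI) (auto intro!: less_imp_le)

lemma diversity_less_small_layer:
  assumes "finite S" "S \<subseteq> V" "imin \<le> j" "j \<le> imax" "card (C j) < card S" "finite V"
  shows "diversity S < 2 * (b powi (j + 1) / (b - 1))"
proof -
  obtain f where f: "f ` S \<subseteq> C j" and d: "\<And>s s'. s \<in> S \<Longrightarrow> s' \<in> S \<Longrightarrow>
      dist s s' < dist (f s) (f s') + 2 * (b powi (j + 1) / (b - 1))"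
    using ancestors[OF assms(3,4,2)] by metis
  have "\<not> inj_on f S"
  proof
    assume "inj_on f S"
    moreover have "finite (C j)"
      using layer_subset[OF assms(3,4)] assms(6) finite_subset by blast
    ultimately show False using card_inj_on_le[OF _ f] assms(5) by simp
  qed
  then obtain s s' where "s \<in> S" "s' \<in> S" "s \<noteq> s'" "f s = f s'"
    unfolding inj_on_def by blast
  thus ?thesis using d[of s s'] diversity_le_dist[OF assms(1), of s s'] by simp
qed

lemma ex_diverse_layer_subset:
  assumes "finite S" "S \<subseteq> V" "card S \<ge> 2" "imin \<le> j" "j \<le> imax" "card S \<le> card (C j)"
  shows "\<exists>T \<subseteq> C j. card T = card S \<and>
    diversity S - 2 * (b powi (j + 1) / (b - 1)) \<le> diversity T"
proof -
  obtain f where f: "f ` S \<subseteq> C j" and d: "\<And>s s'. s \<in> S \<Longrightarrow> s' \<in> S \<Longrightarrow>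
      dist s s' < dist (f s) (f s') + 2 * (b powi (j + 1) / (b - 1))"
    using ancestors[OF assms(4,5,2)] by metis
  show ?thesis
  proof (cases "inj_on f S")
    case True
    have "diversity S - 2 * (b powi (j + 1) / (b - 1)) \<le> diversity (f ` S)"
    proof (rule diversity_geI)
      show "2 \<le> card (f ` S)" using True assms(3) by (simp add: card_image)
    next
      fix x y assume "x \<in> f ` S" "y \<in> f ` S" "x \<noteq> y"
      then obtain s s' where s: "s \<in> S" "s' \<in> S" "x = f s" "y = f s'" "s \<noteq> s'" by auto
      show "diversity S - 2 * (b powi (j + 1) / (b - 1)) \<le> dist x y"
        using d[OF s(1,2)] diversity_le_dist[OF assms(1) s(1,2,5)] s(3,4) by simp
    qed
    thus ?thesis using f True by (intro exI[of _ "f ` S"]) (simp add: card_image)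
  next
    case False
    then obtain s s' where s: "s \<in> S" "s' \<in> S" "s \<noteq> s'" "f s = f s'"
      unfolding inj_on_def by blast
    \<comment> \<open>After a collision the required bound is negative while diversities within the
      layer are nonnegative, so any \<open>T\<close> of the right size will do.\<close>
    have neg: "diversity S - 2 * (b powi (j + 1) / (b - 1)) < 0"
      using d[OF s(1,2)] diversity_le_dist[OF assms(1) s(1-3)] s(4) by simp
    obtain T where T: "T \<subseteq> C j" "card T = card S"
      using obtain_subset_with_card_n[OF assms(6)] by metis
    have "0 \<le> b powi j" using base_gt_1 by simp
    also have "\<dots> \<le> diversity T"
      using diversity_layer_ge[OF assms(4,5) T(1)] T(2) assms(3) by simp
    finally show ?thesis using neg T by (intro exI[of _ T]) simp
  qed
qed

end

text \<open>As \<beta> grows, the first bound falls and the second rises. They cross at \<beta> = 1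
  + x with common value d / (1 + x), so their maximum never drops below it.\<close>

lemma divide_le_of_max_le:
  fixes x \<beta> d D :: real
  assumes "\<beta> > 0" "d > 0" "x \<ge> 0" and D: "max (d / \<beta>) (d * (1 - 1 / \<beta> * x)) \<le> D"
  shows "d / D \<le> 1 + x"
proof -
  have "d / (1 + x) \<le> D"
  proof (cases "\<beta> \<le> 1 + x")
    case True
    hence "d / (1 + x) \<le> d / \<beta>" using assms by (intro divide_left_mono) auto
    thus ?thesis using D by simp
  next
    case False
    hence "x / \<beta> \<le> x / (1 + x)" using assms by (intro divide_left_mono) auto
    hence "1 / (1 + x) \<le> 1 - 1 / \<beta> * x" using assms by (simp add: field_simps)
    hence "d * (1 / (1 + x)) \<le> d * (1 - 1 / \<beta> * x)"
      using assms by (intro mult_left_mono) auto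
    thus ?thesis using D by simp
  qed
  moreover have "0 < d / (1 + x)" using assms by simp
  ultimately have "0 < D" by linarith
  thus ?thesis using \<open>d / (1 + x) \<le> D\<close> assms by (simp add: field_simps)
qed

theorem theorem1:
  fixes V :: "'a::metric_space set"
    and k :: nat
    and b \<beta> :: real
    and imin imax i :: int
    and L :: "int \<Rightarrow> 'a set"
    and par :: "int \<Rightarrow> 'a \<Rightarrow> 'a"
  assumes "finite V"
    and "2 \<le> k" and "k \<le> card V"
    and "cover_tree V b imin imax L par"
    and "imin \<le> i" and "i \<le> imax"
    and "card (L i) \<ge> k"
    and "\<And>j. i < j \<Longrightarrow> j \<le> imax \<Longrightarrow> card (L j) < k"
    and "\<beta> > 0"
    and "b powi i = opt_diversity V k / \<beta>"
  shows "(\<forall>C. C \<subseteq> L i \<and> card C \<ge> 2 \<longrightarrow> diversity C \<ge> opt_diversity V k / \<beta>) \<and>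
         (\<exists>C. C \<subseteq> L i \<and> card C = k \<and>
            diversity C \<ge> max (opt_diversity V k / \<beta>)
              (opt_diversity V k * (1 - 1 / \<beta> * (2 * b / (b - 1))))) \<and>
         \<beta> < 2 * b\<^sup>2 / (b - 1) \<and>
         (\<forall>C. C \<subseteq> L i \<and> card C = k \<and>
            diversity C \<ge> max (opt_diversity V k / \<beta>)
              (opt_diversity V k * (1 - 1 / \<beta> * (2 * b / (b - 1)))) \<longrightarrow>
            opt_diversity V k / diversity C \<le> 1 + 2 * b / (b - 1))"
proof -
  interpret cover_tree V b imin imax L par by fact
  let ?d = "opt_diversity V k"
  let ?x = "2 * b / (b - 1)"
  note i = \<open>imin \<le> i\<close> \<open>i \<le> imax\<close>
  have b: "b > 1" by (rule base_gt_1)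
  have x: "?x \<ge> 0" using b by simp
  have d: "?d = \<beta> * b powi i" using assms(9,10) by (simp add: field_simps)
  have dpos: "?d > 0" using d \<open>\<beta> > 0\<close> b by simp
  have separated: "?d / \<beta> \<le> diversity T" if "T \<subseteq> L i" "card T \<ge> 2" for T
    using diversity_layer_ge[OF i that] assms(10) by simp
  obtain S where S: "S \<subseteq> V" "card S = k" "diversity S = ?d"
    using opt_diversity_attained[OF assms(1,3)] by metis
  have "finite S" using S(1) assms(1) finite_subset by blast
  \<comment> \<open>The root layer has one point, fewer than \<open>k\<close>. Hence layer
    \<open>i + 1\<close> exists, and by termination it is too small to hold \<open>k\<close>
    points.\<close>
  have "i \<noteq> imax" using root assms(2,7) by auto
  hence i': "imin \<le> i + 1" "i + 1 \<le> imax" using i by auto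

  have part2: "\<exists>T. T \<subseteq> L i \<and> card T = k \<and>
    max (?d / \<beta>) (?d * (1 - 1 / \<beta> * ?x)) \<le> diversity T"
  proof -
    obtain T where T: "T \<subseteq> L i" "card T = k"
        "?d - 2 * (b powi (i + 1) / (b - 1)) \<le> diversity T"
      using ex_diverse_layer_subset[OF \<open>finite S\<close> S(1) _ i] S(2,3) assms(2,7) by auto
    \<comment> \<open>With b^i equal to \<open>?d / \<beta>\<close>, the absolute loss of two radii
      becomes a fraction of \<open>?d\<close>.\<close>
    have "2 * (b powi (i + 1) / (b - 1)) = b powi i * ?x"
      using b by (simp add: power_int_add_1)
    hence "?d * (1 - 1 / \<beta> * ?x) = ?d - 2 * (b powi (i + 1) / (b - 1))"
      unfolding assms(10) by (simp add: algebra_simps)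
    thus ?thesis using T separated[OF T(1)] assms(2) by auto
  qed

  have part3: "\<beta> < 2 * b\<^sup>2 / (b - 1)"
  proof -
    \<comment> \<open>The square of b has two sources: one factor from moving up to layer
      \<open>i + 1\<close>, the other from the covering radius of that layer.\<close>
    have "?d < 2 * (b powi (i + 1 + 1) / (b - 1))"
      using diversity_less_small_layer[OF \<open>finite S\<close> S(1) i' _ assms(1)] S(2,3)
        assms(8)[of "i + 1"] i' by simp
    also have "\<dots> = 2 * b\<^sup>2 / (b - 1) * b powi i"
      using b power_int_add_1[of b "i + 1"] power_int_add_1[of b i]
      by (simp add: power2_eq_square del: add.assoc)
    finally have "\<beta> * b powi i < 2 * b\<^sup>2 / (b - 1) * b powi i" using d by simp
    thus ?thesis by (rule mult_right_less_imp_less) (use b in simp)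
  qed

  show ?thesis
    using separated part2 part3 divide_le_of_max_le[OF \<open>\<beta> > 0\<close> dpos x] by blast
qed

end
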